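(* Let $(T,+,\Gamma)$ be a commutative ternary $\Gamma$-semiring. If $Q$ is a primary ideal of $T$, then $\sqrt{Q}$ is a prime ideal of $T$.
   Context: A ternary $\Gamma$-semiring $(T,+,\Gamma)$ consists of a set $T$, an addition $+$, a set $\Gamma$ of parameters, and a map $T\times\Gamma\times T\times\Gamma\times T\to T$, $(a,\alpha,b,\beta,c)\mapsto a_{\alpha}b_{\beta}c$, such that: $(T,+)$ is a commutative semigroup with identity element $0$; $(a_{\alpha}b_{\beta}c)_{\gamma}d_{\delta}e=a_{\alpha}b_{\beta}(c_{\gamma}d_{\delta}e)$; the product is additive in each of its three $T$-variables; and $0_{\alpha}b_{\beta}c=a_{\alpha}0_{\beta}c=a_{\alpha}b_{\beta}0=0$. It is commutative if $a_{\alpha}b_{\beta}c=b_{\beta}a_{\alpha}c=c_{\alpha}b_{\beta}a$ for all $a,b,c\in T$, $\alpha,\beta\in\Gamma$. An ideal is a nonempty $I\subseteq T$ closed under $+$ such that $a_{\alpha}b_{\beta}c\in I$ whenever at least one of $a,b,c\in T$ lies in $I$ (all $\alpha,\beta\in\Gamma$). An ideal $P\ne T$ is prime if for all $a,b,c\in T$, $\alpha,\beta\in\Gamma$: $a_{\alpha}b_{\beta}c\in P$ implies $a\in P$ or $b\in P$ or $c\in P$. An ideal $Q\ne T$ is primary if for all $a,b,c\in T$, $\alpha,\beta\in\Gamma$: $a_{\alpha}b_{\beta}c\in Q$ and $a\notin Q$ imply $b_{\alpha}b_{\beta}b\in Q$ or $c_{\alpha}c_{\beta}c\in Q$. The (prime)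 radical of an ideal $I$ is $\sqrt{I}=\bigcap\{P\mid P\text{ a prime ideal of }T,\ I\subseteq P\}$.
   Formalization: The formal theorem additionally assumes that at least one prime ideal of T contains Q; without this √Q is an empty intersection (e.g. T={0,1} with + = or and all products zero, Q={0}), read as T, which is not a prime ideal. *)

theory Defs
  imports Main
begin

record ('a, 'g) ternary_gamma =
  elems :: "'a set"
  params :: "'g set"
  tadd :: "'a \<Rightarrow> 'a \<Rightarrow> 'a"
  tzero :: 'a
  tprod :: "'a \<Rightarrow> 'g \<Rightarrow> 'a \<Rightarrow> 'g \<Rightarrow> 'a \<Rightarrow> 'a"

locale ternary_gamma_semiring =
  fixes R :: "('a, 'g) ternary_gamma"
  assumes add_closed: "\<lbrakk>a \<in> elems R; b \<in> elems R\<rbrakk> \<Longrightarrow> tadd R a b \<in> elems R"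
    and add_assoc: "\<lbrakk>a \<in> elems R; b \<in> elems R; c \<in> elems R\<rbrakk>
      \<Longrightarrow> tadd R (tadd R a b) c = tadd R a (tadd R b c)"
    and add_comm: "\<lbrakk>a \<in> elems R; b \<in> elems R\<rbrakk> \<Longrightarrow> tadd R a b = tadd R b a"
    and zero_closed: "tzero R \<in> elems R"
    and add_zero: "a \<in> elems R \<Longrightarrow> tadd R a (tzero R) = a"
    and prod_closed: "\<lbrakk>a \<in> elems R; b \<in> elems R; c \<in> elems R; \<alpha> \<in> params R; \<beta> \<in> params R\<rbrakk>
      \<Longrightarrow> tprod R a \<alpha> b \<beta> c \<in> elems R"
    and prod_assoc: "\<lbrakk>a \<in> elems R; b \<in> elems R; c \<in> elems R; d \<in> elems R; e \<in> elems R;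
        \<alpha> \<in> params R; \<beta> \<in> params R; \<gamma> \<in> params R; \<delta> \<in> params R\<rbrakk>
      \<Longrightarrow> tprod R (tprod R a \<alpha> b \<beta> c) \<gamma> d \<delta> e = tprod R a \<alpha> b \<beta> (tprod R c \<gamma> d \<delta> e)"
    and prod_add_left: "\<lbrakk>a \<in> elems R; a' \<in> elems R; b \<in> elems R; c \<in> elems R;
        \<alpha> \<in> params R; \<beta> \<in> params R\<rbrakk>
      \<Longrightarrow> tprod R (tadd R a a') \<alpha> b \<beta> c = tadd R (tprod R a \<alpha> b \<beta> c) (tprod R a' \<alpha> b \<beta> c)"
    and prod_add_middle: "\<lbrakk>a \<in> elems R; b \<in> elems R; b' \<in> elems R; c \<in> elems R;
        \<alpha> \<in> params R; \<beta> \<in> params R\<rbrakk>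
      \<Longrightarrow> tprod R a \<alpha> (tadd R b b') \<beta> c = tadd R (tprod R a \<alpha> b \<beta> c) (tprod R a \<alpha> b' \<beta> c)"
    and prod_add_right: "\<lbrakk>a \<in> elems R; b \<in> elems R; c \<in> elems R; c' \<in> elems R;
        \<alpha> \<in> params R; \<beta> \<in> params R\<rbrakk>
      \<Longrightarrow> tprod R a \<alpha> b \<beta> (tadd R c c') = tadd R (tprod R a \<alpha> b \<beta> c) (tprod R a \<alpha> b \<beta> c')"
    and prod_zero_left: "\<lbrakk>b \<in> elems R; c \<in> elems R; \<alpha> \<in> params R; \<beta> \<in> params R\<rbrakk>
      \<Longrightarrow> tprod R (tzero R) \<alpha> b \<beta> c = tzero R"
    and prod_zero_middle: "\<lbrakk>a \<in> elems R; c \<in> elems R; \<alpha> \<in> params R; \<beta> \<in> params R\<rbrakk>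
      \<Longrightarrow> tprod R a \<alpha> (tzero R) \<beta> c = tzero R"
    and prod_zero_right: "\<lbrakk>a \<in> elems R; b \<in> elems R; \<alpha> \<in> params R; \<beta> \<in> params R\<rbrakk>
      \<Longrightarrow> tprod R a \<alpha> b \<beta> (tzero R) = tzero R"

text \<open>In the first commutativity law the parameters are exchanged together with the factors;
  in the second they stay in place.\<close>

locale comm_ternary_gamma_semiring = ternary_gamma_semiring +
  assumes prod_comm_first: "\<lbrakk>a \<in> elems R; b \<in> elems R; c \<in> elems R; \<alpha> \<in> params R; \<beta> \<in> params R\<rbrakk>
      \<Longrightarrow> tprod R a \<alpha> b \<beta> c = tprod R b \<beta> a \<alpha> c"
    and prod_comm_outer: "\<lbrakk>a \<in> elems R; b \<in> elems R; c \<in> elems R; \<alpha> \<in> params R; \<beta> \<in> params R\<rbrakk>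
      \<Longrightarrow> tprod R a \<alpha> b \<beta> c = tprod R c \<alpha> b \<beta> a"

definition tideal :: "('a, 'g) ternary_gamma \<Rightarrow> 'a set \<Rightarrow> bool" where
  "tideal R I \<longleftrightarrow> I \<noteq> {} \<and> I \<subseteq> elems R \<and>
     (\<forall>a\<in>I. \<forall>b\<in>I. tadd R a b \<in> I) \<and>
     (\<forall>a\<in>elems R. \<forall>b\<in>elems R. \<forall>c\<in>elems R. \<forall>\<alpha>\<in>params R. \<forall>\<beta>\<in>params R.
        a \<in> I \<or> b \<in> I \<or> c \<in> I \<longrightarrow> tprod R a \<alpha> b \<beta> c \<in> I)"

definition prime_tideal :: "('a, 'g) ternary_gamma \<Rightarrow> 'a set \<Rightarrow> bool" where
  "prime_tideal R P \<longleftrightarrow> tideal R P \<and> P \<noteq> elems R \<and>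
     (\<forall>a\<in>elems R. \<forall>b\<in>elems R. \<forall>c\<in>elems R. \<forall>\<alpha>\<in>params R. \<forall>\<beta>\<in>params R.
        tprod R a \<alpha> b \<beta> c \<in> P \<longrightarrow> a \<in> P \<or> b \<in> P \<or> c \<in> P)"

definition primary_tideal :: "('a, 'g) ternary_gamma \<Rightarrow> 'a set \<Rightarrow> bool" where
  "primary_tideal R Q \<longleftrightarrow> tideal R Q \<and> Q \<noteq> elems R \<and>
     (\<forall>a\<in>elems R. \<forall>b\<in>elems R. \<forall>c\<in>elems R. \<forall>\<alpha>\<in>params R. \<forall>\<beta>\<in>params R.
        tprod R a \<alpha> b \<beta> c \<in> Q \<and> a \<notin> Q \<longrightarrow>
          tprod R b \<alpha> b \<beta> b \<in> Q \<or> tprod R c \<alpha> c \<beta> c \<in> Q)"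

definition primes_over :: "('a, 'g) ternary_gamma \<Rightarrow> 'a set \<Rightarrow> 'a set set" where
  "primes_over R I = {P. prime_tideal R P \<and> I \<subseteq> P}"

text \<open>The family of primes over a proper ideal may be empty: if all products in \<open>R\<close> are zero
  and \<open>R\<close> has a parameter and a nonzero element, then the zero ideal is primary but \<open>R\<close>
  has no prime ideal at all.  The radical is meaningful as an intersection only when
  \<open>primes_over R I\<close> is nonempty; otherwise the value below is all of \<open>elems R\<close>, which is
  never a prime ideal.\<close>

definition tradical :: "('a, 'g) ternary_gamma \<Rightarrow> 'a set \<Rightarrow> 'a set" where
  "tradical R I = elems R \<inter> \<Inter> (primes_over R I)"

end

(* Let a, b, c lie outside the radical of Q, and choose primes Pa, Pb, Pc over Q avoiding a, b, c
   respectively.  The set S of all products of an element outside Pa, an element outside Pb and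
   an element outside Pc is closed under the ternary products, because commutativity and
   associativity allow factors to be rearranged, and it is disjoint from Q because Q is primary.
   An ideal I maximal among those containing Q and disjoint from S avoids the product of a, b, c.
   It is prime: if x y z lies in I but none of x, y, z does, then the ideal of all t with t y z
   in I contains x, hence meets S by maximality, so x may be replaced by an element of S; doing
   the same for y and z yields an element of S in I. *)

theory Submission
  imports Defs
begin

section \<open>Elementary facts on ideals\<close>

lemma tidealI:
  assumes "I \<noteq> {}" "I \<subseteq> elems R"
    and "\<And>a b. \<lbrakk>a \<in> I; b \<in> I\<rbrakk> \<Longrightarrow> tadd R a b \<in> I"
    and "\<And>a b c \<alpha> \<beta>. \<lbrakk>a \<in> elems R; b \<in> elems R; c \<in> elems R; \<alpha> \<in> params R; \<beta> \<in> params R;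
        a \<in> I \<or> b \<in> I \<or> c \<in> I\<rbrakk> \<Longrightarrow> tprod R a \<alpha> b \<beta> c \<in> I"
  shows "tideal R I"
  using assms unfolding tideal_def by blast

lemma tideal_subset: "tideal R I \<Longrightarrow> I \<subseteq> elems R"
  by (simp add: tideal_def)

lemma tideal_add: "\<lbrakk>tideal R I; a \<in> I; b \<in> I\<rbrakk> \<Longrightarrow> tadd R a b \<in> I"
  by (simp add: tideal_def)

lemma tideal_prod:
  "\<lbrakk>tideal R I; a \<in> elems R; b \<in> elems R; c \<in> elems R; \<alpha> \<in> params R; \<beta> \<in> params R;
    a \<in> I \<or> b \<in> I \<or> c \<in> I\<rbrakk> \<Longrightarrow> tprod R a \<alpha> b \<beta> c \<in> I"
  unfolding tideal_def by blast

lemma prime_tidealD: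
  "\<lbrakk>prime_tideal R P; a \<in> elems R; b \<in> elems R; c \<in> elems R; \<alpha> \<in> params R; \<beta> \<in> params R;
    tprod R a \<alpha> b \<beta> c \<in> P\<rbrakk> \<Longrightarrow> a \<in> P \<or> b \<in> P \<or> c \<in> P"
  unfolding prime_tideal_def by blast

lemma primary_tidealD:
  "\<lbrakk>primary_tideal R Q; a \<in> elems R; b \<in> elems R; c \<in> elems R; \<alpha> \<in> params R; \<beta> \<in> params R;
    tprod R a \<alpha> b \<beta> c \<in> Q; a \<notin> Q\<rbrakk> \<Longrightarrow> tprod R b \<alpha> b \<beta> b \<in> Q \<or> tprod R c \<alpha> c \<beta> c \<in> Q"
  unfolding primary_tideal_def by blast

lemma tideal_Union_chain:
  assumes "\<C> \<noteq> {}" and ideals: "\<And>I. I \<in> \<C> \<Longrightarrow> tideal R I"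
    and chain: "\<And>I J. \<lbrakk>I \<in> \<C>; J \<in> \<C>\<rbrakk> \<Longrightarrow> I \<subseteq> J \<or> J \<subseteq> I"
  shows "tideal R (\<Union>\<C>)"
proof (rule tidealI)
  show "\<Union>\<C> \<noteq> {}" using assms(1) ideals by (fastforce simp: tideal_def)
  show "\<Union>\<C> \<subseteq> elems R" using ideals tideal_subset by blast
next
  fix a b assume "a \<in> \<Union>\<C>" "b \<in> \<Union>\<C>"
  then obtain I J where IJ: "I \<in> \<C>" "J \<in> \<C>" "a \<in> I" "b \<in> J" by blast
  then obtain K where K: "K \<in> \<C>" "a \<in> K" "b \<in> K" using chain[OF IJ(1,2)] by blast
  then have "tadd R a b \<in> K" by (intro tideal_add ideals)
  then show "tadd R a b \<in> \<Union>\<C>" using K by blast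
next
  fix a b c \<alpha> \<beta>
  assume mem: "a \<in> elems R" "b \<in> elems R" "c \<in> elems R" "\<alpha> \<in> params R" "\<beta> \<in> params R"
    and "a \<in> \<Union>\<C> \<or> b \<in> \<Union>\<C> \<or> c \<in> \<Union>\<C>"
  then obtain I where I: "I \<in> \<C>" "a \<in> I \<or> b \<in> I \<or> c \<in> I" by blast
  then have "tprod R a \<alpha> b \<beta> c \<in> I" using mem by (intro tideal_prod ideals)
  then show "tprod R a \<alpha> b \<beta> c \<in> \<Union>\<C>" using I by blast
qed

context ternary_gamma_semiring
begin

text \<open>A parameter is what makes absorption effective: multiplying an element of
  \<open>I\<close> by zeros gives zero. With no parameters, any nonempty additively closed subset is
  an ideal, and it may miss zero.\<close>

lemma zero_in_tideal:
  assumes "tideal R I" "\<alpha> \<in> params R"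
  shows "tzero R \<in> I"
proof -
  obtain a where a: "a \<in> I" using assms unfolding tideal_def by blast
  then have "tprod R a \<alpha> (tzero R) \<alpha> (tzero R) \<in> I"
    using assms zero_closed tideal_subset by (intro tideal_prod) auto
  then show ?thesis using a assms zero_closed prod_zero_right tideal_subset[OF assms(1)] by auto
qed

end

section \<open>Permuting the factors of products\<close>

context comm_ternary_gamma_semiring
begin

text \<open>The first commutativity law is applied before and after the outer swap, so its exchange
  of the parameters cancels. Together with the outer swap, this transposition generates all
  permutations of the factors with the parameters kept in place.\<close>

lemma prod_comm_right:
  assumes "a \<in> elems R" "b \<in> elems R" "c \<in> elems R" "\<alpha> \<in> params R" "\<beta> \<in> params R"
  shows "tprod R a \<alpha> b \<beta> c = tprod R a \<alpha> c \<beta> b"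
proof -
  have "tprod R a \<alpha> b \<beta> c = tprod R b \<beta> a \<alpha> c" using assms by (rule prod_comm_first)
  also have "\<dots> = tprod R c \<beta> a \<alpha> b" using assms by (intro prod_comm_outer)
  also have "\<dots> = tprod R a \<alpha> c \<beta> b" using assms by (intro prod_comm_first)
  finally show ?thesis .
qed

lemma prod_rotate:
  assumes "a \<in> elems R" "b \<in> elems R" "c \<in> elems R" "\<alpha> \<in> params R" "\<beta> \<in> params R"
  shows "tprod R a \<alpha> b \<beta> c = tprod R b \<alpha> c \<beta> a"
proof -
  have "tprod R a \<alpha> b \<beta> c = tprod R c \<alpha> b \<beta> a" using assms by (rule prod_comm_outer)
  also have "\<dots> = tprod R c \<alpha> a \<beta> b" using assms by (intro prod_comm_right)
  also have "\<dots> = tprod R b \<alpha> a \<beta> c" using assms by (intro prod_comm_outer)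
  also have "\<dots> = tprod R b \<alpha> c \<beta> a" using assms by (intro prod_comm_right)
  finally show ?thesis .
qed

lemma prod_comm_left:
  assumes "a \<in> elems R" "b \<in> elems R" "c \<in> elems R" "\<alpha> \<in> params R" "\<beta> \<in> params R"
  shows "tprod R a \<alpha> b \<beta> c = tprod R b \<alpha> a \<beta> c"
proof -
  have "tprod R a \<alpha> b \<beta> c = tprod R b \<alpha> c \<beta> a" using assms by (rule prod_rotate)
  also have "\<dots> = tprod R b \<alpha> a \<beta> c" using assms by (intro prod_comm_right)
  finally show ?thesis .
qed

text \<open>Arrange the nine factors in a 3 by 3 array: the product of the row products equals the
  product of the column products, with the parameter pairs redistributed. This gives closure of the
  set of products used for the radical: each column collects the factors that avoid one and the same
  prime.\<close>

lemma prod_transpose: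
  assumes X: "a1 \<in> elems R" "b1 \<in> elems R" "c1 \<in> elems R"
      "a2 \<in> elems R" "b2 \<in> elems R" "c2 \<in> elems R"
      "a3 \<in> elems R" "b3 \<in> elems R" "c3 \<in> elems R"
    and G: "\<alpha>1 \<in> params R" "\<beta>1 \<in> params R" "\<alpha>2 \<in> params R" "\<beta>2 \<in> params R"
      "\<alpha>3 \<in> params R" "\<beta>3 \<in> params R" "\<gamma> \<in> params R" "\<delta> \<in> params R"
  shows "tprod R (tprod R a1 \<alpha>1 b1 \<beta>1 c1) \<gamma> (tprod R a2 \<alpha>2 b2 \<beta>2 c2) \<delta> (tprod R a3 \<alpha>3 b3 \<beta>3 c3)
    = tprod R (tprod R a1 \<gamma> a2 \<delta> a3) \<alpha>3 (tprod R b1 \<alpha>1 b2 \<beta>1 b3) \<beta>3 (tprod R c1 \<alpha>2 c2 \<beta>2 c3)"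
proof -
  \<comment> \<open>Each parameter pair is frozen into its own ternary operation, so that the
    calculation only tracks the order of the factors and the nesting of the four operations.\<close>
  define f where "f x y z = tprod R x \<gamma> y \<delta> z" for x y z
  define f1 where "f1 x y z = tprod R x \<alpha>1 y \<beta>1 z" for x y z
  define f2 where "f2 x y z = tprod R x \<alpha>2 y \<beta>2 z" for x y z
  define f3 where "f3 x y z = tprod R x \<alpha>3 y \<beta>3 z" for x y z
  note fs = f_def f1_def f2_def f3_def
  have cl: "f x y z \<in> elems R" "f1 x y z \<in> elems R" "f2 x y z \<in> elems R" "f3 x y z \<in> elems R"
    if "x \<in> elems R" "y \<in> elems R" "z \<in> elems R" for x y z
    using that G unfolding fs by (auto intro: prod_closed)
  have rot: "f x y z = f y z x" "f1 x y z = f1 y z x" "f2 x y z = f2 y z x" "f3 x y z = f3 y z x"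
    if "x \<in> elems R" "y \<in> elems R" "z \<in> elems R" for x y z
    using that G unfolding fs by (blast intro: prod_rotate)+
  have swl: "f x y z = f y x z" "f1 x y z = f1 y x z" "f2 x y z = f2 y x z" "f3 x y z = f3 y x z"
    if "x \<in> elems R" "y \<in> elems R" "z \<in> elems R" for x y z
    using that G unfolding fs by (blast intro: prod_comm_left)+
  have swo: "f x y z = f z y x" "f1 x y z = f1 z y x" "f2 x y z = f2 z y x" "f3 x y z = f3 z y x"
    if "x \<in> elems R" "y \<in> elems R" "z \<in> elems R" for x y z
    using that G unfolding fs by (blast intro: prod_comm_outer)+
  \<comment> \<open>Associativity leaves every parameter in its place between the factors, so
    regrouping makes the inner and the outer operation trade places.\<close>
  have as: "f (f1 x y z) u v = f1 x y (f z u v)" "f (f2 x y z) u v = f2 x y (f z u v)"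
    "f (f3 x y z) u v = f3 x y (f z u v)" "f2 (f3 x y z) u v = f3 x y (f2 z u v)"
    "f1 (f3 x y z) u v = f3 x y (f1 z u v)" "f2 (f1 x y z) u v = f1 x y (f2 z u v)"
    "f3 (f2 x y z) u v = f2 x y (f3 z u v)"
    if "x \<in> elems R" "y \<in> elems R" "z \<in> elems R" "u \<in> elems R" "v \<in> elems R" for x y z u v
    using that G unfolding fs by (blast intro: prod_assoc)+
  let ?A = "f a1 a2 a3" and ?B = "f1 b1 b2 b3" and ?C = "f2 c1 c2 c3"
  note mem = X cl
  \<comment> \<open>First the first column is gathered: \<open>f\<close> is pushed inwards past
    \<open>f1\<close>, \<open>f2\<close> and \<open>f3\<close> until it joins \<open>a1\<close>,
    \<open>a2\<close>, \<open>a3\<close>, giving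
    \<open>f1 b1 c1 (f2 b2 c2 (f3 b3 c3 ?A))\<close>.\<close>
  have "f (f1 a1 b1 c1) (f2 a2 b2 c2) (f3 a3 b3 c3) = f (f1 b1 c1 a1) (f2 a2 b2 c2) (f3 a3 b3 c3)"
    by (simp only: rot(2)[of a1 b1 c1] mem)
  also have "\<dots> = f1 b1 c1 (f a1 (f2 a2 b2 c2) (f3 a3 b3 c3))"
    by (rule as) (simp_all add: mem)
  also have "f a1 (f2 a2 b2 c2) (f3 a3 b3 c3) = f (f2 a2 b2 c2) a1 (f3 a3 b3 c3)"
    by (rule swl) (simp_all add: mem)
  also have "\<dots> = f (f2 b2 c2 a2) a1 (f3 a3 b3 c3)"
    by (simp only: rot(3)[of a2 b2 c2] mem)
  also have "\<dots> = f2 b2 c2 (f a2 a1 (f3 a3 b3 c3))"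
    by (rule as) (simp_all add: mem)
  also have "f a2 a1 (f3 a3 b3 c3) = f (f3 a3 b3 c3) a1 a2"
    by (rule swo) (simp_all add: mem)
  also have "\<dots> = f (f3 b3 c3 a3) a1 a2"
    by (simp only: rot(4)[of a3 b3 c3] mem)
  also have "\<dots> = f3 b3 c3 (f a3 a1 a2)"
    by (rule as) (simp_all add: mem)
  also have "f a3 a1 a2 = ?A"
    by (rule rot) (simp_all add: mem)
  \<comment> \<open>Next \<open>f3\<close>, which carries \<open>?A\<close>, is moved outermost,
    past \<open>f2\<close> and then \<open>f1\<close>.\<close>
  also have "f2 b2 c2 (f3 b3 c3 ?A) = f2 (f3 b3 c3 ?A) b2 c2"
    by (rule rot[symmetric]) (simp_all add: mem)
  also have "f3 b3 c3 ?A = f3 ?A c3 b3"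
    by (rule swo) (simp_all add: mem)
  also have "f2 (f3 ?A c3 b3) b2 c2 = f3 ?A c3 (f2 b3 b2 c2)"
    by (rule as) (simp_all add: mem)
  also have "f1 b1 c1 (f3 ?A c3 (f2 b3 b2 c2)) = f1 (f3 ?A c3 (f2 b3 b2 c2)) b1 c1"
    by (rule rot[symmetric]) (simp_all add: mem)
  also have "\<dots> = f3 ?A c3 (f1 (f2 b3 b2 c2) b1 c1)"
    by (rule as) (simp_all add: mem)
  \<comment> \<open>Inside the last argument of \<open>f3\<close>, the second column is gathered
    under \<open>f1\<close>; the argument becomes \<open>f2 c1 c2 ?B\<close>.\<close>
  also have "f1 (f2 b3 b2 c2) b1 c1 = f1 c1 b1 (f2 b3 b2 c2)"
    by (rule swo) (simp_all add: mem)
  also have "f2 b3 b2 c2 = f2 b2 b3 c2"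
    by (rule swl) (simp_all add: mem)
  also have "f1 c1 b1 (f2 b2 b3 c2) = f2 (f1 c1 b1 b2) b3 c2"
    by (rule as[symmetric]) (simp_all add: mem)
  also have "f1 c1 b1 b2 = f1 b1 b2 c1"
    by (rule rot) (simp_all add: mem)
  also have "f2 (f1 b1 b2 c1) b3 c2 = f1 b1 b2 (f2 c1 b3 c2)"
    by (rule as) (simp_all add: mem)
  also have "f2 c1 b3 c2 = f2 b3 c1 c2"
    by (rule swl) (simp_all add: mem)
  also have "f1 b1 b2 (f2 b3 c1 c2) = f2 ?B c1 c2"
    by (rule as[symmetric]) (simp_all add: mem)
  also have "f2 ?B c1 c2 = f2 c1 c2 ?B"
    by (rule rot) (simp_all add: mem)
  \<comment> \<open>Finally \<open>c3\<close> is brought to \<open>c1\<close> and \<open>c2\<close>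
    under \<open>f2\<close>, which completes the third column.\<close>
  also have "f3 ?A c3 (f2 c1 c2 ?B) = f3 (f2 c1 c2 ?B) ?A c3"
    by (rule rot[symmetric]) (simp_all add: mem)
  also have "\<dots> = f2 c1 c2 (f3 ?B ?A c3)"
    by (rule as) (simp_all add: mem)
  also have "f3 ?B ?A c3 = f3 c3 ?A ?B"
    by (rule swo) (simp_all add: mem)
  also have "f2 c1 c2 (f3 c3 ?A ?B) = f3 ?C ?A ?B"
    by (rule as[symmetric]) (simp_all add: mem)
  also have "\<dots> = f3 ?A ?B ?C"
    by (rule rot) (simp_all add: mem)
  finally show ?thesis unfolding fs .
qed

section \<open>Colon ideals and the existence of primes disjoint from a multiplicative set\<close>

lemma tideal_colon:
  assumes I: "tideal R I" and b: "b \<in> elems R" and c: "c \<in> elems R"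
    and G: "\<alpha> \<in> params R" "\<beta> \<in> params R"
  shows "tideal R {t \<in> elems R. tprod R t \<alpha> b \<beta> c \<in> I}" (is "tideal R ?K")
proof (rule tidealI)
  have "tzero R \<in> ?K"
    using zero_in_tideal[OF I G(1)] prod_zero_left[OF b c G] zero_closed by simp
  then show "?K \<noteq> {}" by blast
  show "?K \<subseteq> elems R" by blast
next
  fix x y assume "x \<in> ?K" "y \<in> ?K"
  then show "tadd R x y \<in> ?K"
    using b c G add_closed by (auto simp: prod_add_left intro: tideal_add[OF I])
next
  fix x y z \<gamma> \<delta>
  assume mem: "x \<in> elems R" "y \<in> elems R" "z \<in> elems R" and G': "\<gamma> \<in> params R" "\<delta> \<in> params R"
    and K: "x \<in> ?K \<or> y \<in> ?K \<or> z \<in> ?K"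
  \<comment> \<open>By associativity, multiplying a product by \<open>b\<close> and \<open>c\<close>
    affects only its last factor, so absorption in that position comes from \<open>I\<close>.
    Commutativity reduces the other two positions to it.\<close>
  have *: "tprod R u \<gamma> v \<delta> w \<in> ?K" if "u \<in> elems R" "v \<in> elems R" "w \<in> ?K" for u v w
    using that b c G G' prod_closed by (auto simp: prod_assoc intro!: tideal_prod[OF I])
  show "tprod R x \<gamma> y \<delta> z \<in> ?K"
    using K
  proof (elim disjE)
    assume "x \<in> ?K"
    with mem have "tprod R z \<gamma> y \<delta> x \<in> ?K" by (intro *)
    then show ?thesis by (simp only: prod_comm_outer[OF mem G'])
  next
    assume "y \<in> ?K"
    with mem have "tprod R x \<gamma> z \<delta> y \<in> ?K" by (intro *)
    then show ?thesis by (simp only: prod_comm_right[OF mem G'])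
  next
    assume "z \<in> ?K"
    with mem show ?thesis by (intro *)
  qed
qed

lemma maximal_disjoint_tideal_prime:
  assumes I: "tideal R I" "I \<inter> S = {}"
    and maximal: "\<And>J. \<lbrakk>tideal R J; I \<subseteq> J; J \<inter> S = {}\<rbrakk> \<Longrightarrow> J = I"
    and S: "S \<noteq> {}" "S \<subseteq> elems R"
    and closed: "\<And>x y z \<gamma> \<delta>. \<lbrakk>x \<in> S; y \<in> S; z \<in> S; \<gamma> \<in> params R; \<delta> \<in> params R\<rbrakk>
      \<Longrightarrow> tprod R x \<gamma> y \<delta> z \<in> S"
  shows "prime_tideal R I"
  unfolding prime_tideal_def
proof (intro conjI ballI impI)
  show "I \<noteq> elems R" using I S by blast
next
  fix a b c \<alpha> \<beta>
  assume mem: "a \<in> elems R" "b \<in> elems R" "c \<in> elems R" and G: "\<alpha> \<in> params R" "\<beta> \<in> params R"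
    and abc: "tprod R a \<alpha> b \<beta> c \<in> I"
  have replace: "\<exists>s\<in>S. tprod R s \<alpha> y \<beta> z \<in> I"
    if "x \<in> elems R" "y \<in> elems R" "z \<in> elems R" "tprod R x \<alpha> y \<beta> z \<in> I" "x \<notin> I" for x y z
  proof (rule ccontr)
    let ?K = "{t \<in> elems R. tprod R t \<alpha> y \<beta> z \<in> I}"
    assume "\<not> ?thesis"
    moreover have "I \<subseteq> ?K"
      using tideal_subset[OF I(1)] tideal_prod[OF I(1)] that G by blast
    \<comment> \<open>If no element of \<open>S\<close> lay in the colon ideal, maximality would
      collapse it to \<open>I\<close>, although it contains \<open>x\<close> and \<open>I\<close>
      does not.\<close>
    ultimately have "?K = I" using maximal[OF tideal_colon] I that G by blast
    then show False using that by blast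
  qed
  show "a \<in> I \<or> b \<in> I \<or> c \<in> I"
  proof (rule ccontr)
    assume contra: "\<not> ?thesis"
    then obtain s where s: "s \<in> S" "tprod R s \<alpha> b \<beta> c \<in> I"
      using replace mem abc by blast
    then have sR: "s \<in> elems R" using S by blast
    \<comment> \<open>\<open>replace\<close> acts on the first factor only, so the next factor to be
      exchanged is swapped to the front beforehand.\<close>
    then obtain t where t: "t \<in> S" "tprod R t \<alpha> s \<beta> c \<in> I"
      using replace[of b s c] prod_comm_left[of s b c] s mem contra G by metis
    then have tR: "t \<in> elems R" using S by blast
    then obtain u where "u \<in> S" "tprod R u \<alpha> s \<beta> t \<in> I"
      using replace[of c s t] prod_comm_outer[of t s c] sR t mem contra G by metis
    then show False using closed s t I G by blast
  qed
qed (fact I)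

text \<open>A ternary form of Krull's separation lemma, by Zorn's lemma on the ideals that contain
  \<open>Q\<close> and miss \<open>S\<close>.\<close>

lemma exists_prime_disjoint:
  assumes Q: "tideal R Q" "Q \<inter> S = {}"
    and S: "S \<noteq> {}" "S \<subseteq> elems R"
    and closed: "\<And>x y z \<gamma> \<delta>. \<lbrakk>x \<in> S; y \<in> S; z \<in> S; \<gamma> \<in> params R; \<delta> \<in> params R\<rbrakk>
      \<Longrightarrow> tprod R x \<gamma> y \<delta> z \<in> S"
  shows "\<exists>P \<in> primes_over R Q. P \<inter> S = {}"
proof -
  let ?F = "{I. tideal R I \<and> Q \<subseteq> I \<and> I \<inter> S = {}}"
  have chain: "\<Union>\<C> \<in> ?F" if "\<C> \<noteq> {}" "subset.chain ?F \<C>" for \<C>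
  proof -
    have sub: "\<C> \<subseteq> ?F" using that(2) by (simp add: subset_chain_def)
    have "tideal R (\<Union>\<C>)"
      using that sub by (intro tideal_Union_chain) (auto simp: subset_chain_def)
    moreover have "Q \<subseteq> \<Union>\<C>" "\<Union>\<C> \<inter> S = {}" using that(1) sub by blast+
    ultimately show ?thesis by blast
  qed
  have "?F \<noteq> {}" using Q by blast
  then have "\<exists>M\<in>?F. \<forall>X\<in>?F. M \<subseteq> X \<longrightarrow> X = M"
    using chain by (rule subset_Zorn_nonempty)
  then obtain I where I: "I \<in> ?F" and max: "\<forall>J\<in>?F. I \<subseteq> J \<longrightarrow> J = I"
    by (rule bexE)
  have "prime_tideal R I"
  proof (rule maximal_disjoint_tideal_prime[OF _ _ _ S closed])
    show "J = I" if "tideal R J" "I \<subseteq> J" "J \<inter> S = {}" for J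
      using that I by (intro max[rule_format]) auto
  qed (use I in auto)
  then show ?thesis using I unfolding primes_over_def by blast
qed

section \<open>The radical of an ideal and of a primary ideal\<close>

lemma tideal_tradical:
  assumes "tideal R I"
  shows "tideal R (tradical R I)"
proof (rule tidealI)
  have ideals: "tideal R P" if "P \<in> primes_over R I" for P
    using that by (simp add: primes_over_def prime_tideal_def)
  \<comment> \<open>An intersection of ideals might be empty; containing the nonempty set
    \<open>I\<close> rules this out.\<close>
  have "I \<subseteq> tradical R I"
    using tideal_subset[OF assms] by (auto simp: tradical_def primes_over_def)
  then show "tradical R I \<noteq> {}" using assms by (auto simp: tideal_def)
  show "tradical R I \<subseteq> elems R" by (simp add: tradical_def)
  show "tadd R a b \<in> tradical R I" if "a \<in> tradical R I" "b \<in> tradical R I" for a b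
    using that tideal_add[OF ideals] add_closed by (simp add: tradical_def)
  show "tprod R a \<alpha> b \<beta> c \<in> tradical R I"
    if "a \<in> elems R" "b \<in> elems R" "c \<in> elems R" "\<alpha> \<in> params R" "\<beta> \<in> params R"
      "a \<in> tradical R I \<or> b \<in> tradical R I \<or> c \<in> tradical R I" for a b c \<alpha> \<beta>
    using that tideal_prod[OF ideals] prod_closed by (auto simp: tradical_def)
qed

text \<open>The elements \<open>a\<close>, \<open>b\<close>, \<open>c\<close> may be excluded by
  three unrelated primes, none of which is known to exclude the product. A further prime over
  \<open>Q\<close> is therefore constructed that does.\<close>

lemma tradical_primary_prod:
  assumes Q: "primary_tideal R Q"
    and mem: "a \<in> elems R" "b \<in> elems R" "c \<in> elems R" and G: "\<alpha> \<in> params R" "\<beta> \<in> params R"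
    and nota: "a \<notin> tradical R Q" and notb: "b \<notin> tradical R Q" and notc: "c \<notin> tradical R Q"
  shows "tprod R a \<alpha> b \<beta> c \<notin> tradical R Q"
proof -
  have ex: "\<exists>P. prime_tideal R P \<and> Q \<subseteq> P \<and> x \<notin> P"
    if "x \<in> elems R" "x \<notin> tradical R Q" for x
    using that by (auto simp: tradical_def primes_over_def)
  obtain A where A: "prime_tideal R A" "Q \<subseteq> A" "a \<notin> A" using ex mem nota by blast
  obtain B where B: "prime_tideal R B" "Q \<subseteq> B" "b \<notin> B" using ex mem notb by blast
  obtain C where C: "prime_tideal R C" "Q \<subseteq> C" "c \<notin> C" using ex mem notc by blast
  define S where "S = {tprod R x \<gamma> y \<delta> z |x y z \<gamma> \<delta>. x \<in> elems R - A \<and> y \<in> elems R - B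
    \<and> z \<in> elems R - C \<and> \<gamma> \<in> params R \<and> \<delta> \<in> params R}"
  have compl: "tprod R x \<gamma> y \<delta> z \<in> elems R - P"
    if "prime_tideal R P" "x \<in> elems R - P" "y \<in> elems R - P" "z \<in> elems R - P"
      "\<gamma> \<in> params R" "\<delta> \<in> params R" for P x y z \<gamma> \<delta>
    using that prod_closed prime_tidealD[OF that(1)] by blast
  have S_I: "tprod R x \<gamma> y \<delta> z \<in> S" if "x \<in> elems R - A" "y \<in> elems R - B"
    "z \<in> elems R - C" "\<gamma> \<in> params R" "\<delta> \<in> params R" for x y z \<gamma> \<delta>
    unfolding S_def using that by blast
  have abc: "tprod R a \<alpha> b \<beta> c \<in> S"
    using mem G A B C by (intro S_I) auto
  have sub: "S \<subseteq> elems R" unfolding S_def using prod_closed by blast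
  have disj: "Q \<inter> S = {}"
  proof -
    have False if "x \<in> elems R - A" "y \<in> elems R - B" "z \<in> elems R - C"
      and "\<gamma> \<in> params R" "\<delta> \<in> params R" "tprod R x \<gamma> y \<delta> z \<in> Q" for x y z \<gamma> \<delta>
    proof -
      \<comment> \<open>Since \<open>Q\<close> lies in \<open>A\<close>, \<open>x\<close> is outside
        \<open>Q\<close> and the primary condition applies. Either cube it yields would lie in
        \<open>B\<close> or \<open>C\<close>, whose complements are closed under products.\<close>
      have "tprod R y \<gamma> y \<delta> y \<in> Q \<or> tprod R z \<gamma> z \<delta> z \<in> Q"
        using that A(2) by (intro primary_tidealD[OF Q, of x]) auto
      then show False using that B C compl[OF B(1)] compl[OF C(1)] by blast
    qed
    then show ?thesis unfolding S_def by blast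
  qed
  have closed: "tprod R s \<gamma> t \<delta> u \<in> S"
    if "s \<in> S" "t \<in> S" "u \<in> S" and G': "\<gamma> \<in> params R" "\<delta> \<in> params R" for s t u \<gamma> \<delta>
  proof -
    obtain a1 b1 c1 \<alpha>1 \<beta>1 where 1: "s = tprod R a1 \<alpha>1 b1 \<beta>1 c1" "a1 \<in> elems R - A"
      "b1 \<in> elems R - B" "c1 \<in> elems R - C" "\<alpha>1 \<in> params R" "\<beta>1 \<in> params R"
      using \<open>s \<in> S\<close> unfolding S_def by blast
    obtain a2 b2 c2 \<alpha>2 \<beta>2 where 2: "t = tprod R a2 \<alpha>2 b2 \<beta>2 c2" "a2 \<in> elems R - A"
      "b2 \<in> elems R - B" "c2 \<in> elems R - C" "\<alpha>2 \<in> params R" "\<beta>2 \<in> params R"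
      using \<open>t \<in> S\<close> unfolding S_def by blast
    obtain a3 b3 c3 \<alpha>3 \<beta>3 where 3: "u = tprod R a3 \<alpha>3 b3 \<beta>3 c3" "a3 \<in> elems R - A"
      "b3 \<in> elems R - B" "c3 \<in> elems R - C" "\<alpha>3 \<in> params R" "\<beta>3 \<in> params R"
      using \<open>u \<in> S\<close> unfolding S_def by blast
    \<comment> \<open>Transposing groups the factors by the prime they avoid, so each column product
      again avoids that prime.\<close>
    have "tprod R s \<gamma> t \<delta> u
      = tprod R (tprod R a1 \<gamma> a2 \<delta> a3) \<alpha>3 (tprod R b1 \<alpha>1 b2 \<beta>1 b3) \<beta>3 (tprod R c1 \<alpha>2 c2 \<beta>2 c3)"
      unfolding 1(1) 2(1) 3(1) by (rule prod_transpose) (use 1(2-6) 2(2-6) 3(2-6) G' in simp_all)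
    also have "\<dots> \<in> S"
      by (rule S_I) (intro compl A(1) B(1) C(1) 1(2-6) 2(2-6) 3(2-6) G')+
    finally show ?thesis .
  qed
  have "tideal R Q" "S \<noteq> {}" using Q abc by (auto simp: primary_tideal_def)
  then obtain P where "P \<in> primes_over R Q" "P \<inter> S = {}"
    using exists_prime_disjoint[OF _ disj _ sub closed] by blast
  then show ?thesis using abc by (auto simp: tradical_def)
qed

end

theorem proposition5p13:
  fixes R :: "('a, 'g) ternary_gamma" and Q :: "'a set"
  assumes "comm_ternary_gamma_semiring R"
    and "primary_tideal R Q"
    and "primes_over R Q \<noteq> {}"
  shows "prime_tideal R (tradical R Q)"
proof -
  interpret comm_ternary_gamma_semiring R by fact
  \<comment> \<open>Any one prime over \<open>Q\<close> contains the radical and so makes it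
    proper.\<close>
  obtain P where P: "prime_tideal R P" "Q \<subseteq> P"
    using assms(3) by (auto simp: primes_over_def)
  then have "P \<subseteq> elems R" "P \<noteq> elems R" "tradical R Q \<subseteq> P"
    by (auto simp: prime_tideal_def tideal_def tradical_def primes_over_def)
  then have "tradical R Q \<noteq> elems R" by blast
  moreover have "tideal R (tradical R Q)"
    using assms(2) by (intro tideal_tradical) (simp add: primary_tideal_def)
  ultimately show ?thesis
    unfolding prime_tideal_def using tradical_primary_prod[OF assms(2)] by blast
qed

end
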